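(* For every nonnegative measure $\chi=(\chi_x)_{x\in X}$ on $X$, $$\mu\big(e^{-\langle\widehat{l},\chi\rangle}-1\big)=-\log\det(I+GM_\chi)=\log\det(I-G_\chi M_\chi)=\log\det(G_\chi G^{-1}),$$ where $\mu(f)=\int f(l)\,\mu(dl)$, $\langle\widehat{l},\chi\rangle=\sum_x\widehat{l}^x\chi_x$, $M_\chi$ is the diagonal matrix with entries $\chi_x$, and $G_\chi=(M_\lambda+M_\chi-C)^{-1}$.
   Context: Setting. $X$ is a finite set; $C=(C_{x,y})_{x,y\in X}$ is a symmetric matrix with nonnegative entries and zero diagonal (conductances), irreducible; $\kappa=(\kappa_x)_{x\in X}$ is a nonnegative killing measure; $\lambda_x=\kappa_x+\sum_y C_{x,y}>0$; $M_\lambda$ is the diagonal matrix with entries $\lambda_x$. The symmetric matrix $M_\lambda-C$ is assumed positive definite (mass gap). The Green function is $G=(M_\lambda-C)^{-1}$. Loops. A based loop is a pair $(\xi,\tau^* )$ with $p\ge1$, $\xi=(\xi_i)_{i\in\mathbb{Z}/p\mathbb{Z}}\in X^p$ and $\tau^*=(\tau_i^* )_{i\in\mathbb{Z}/p\mathbb{Z}}\in(0,\infty)^p$ (intrinsic holding times). A loop $l$ is an equivalence class of based loops under cyclic rotation of the index. The loop measure $\mu$ is the image on loops of the measure on based loops which is $e^{-\lambda_x\tau^*}\frac{d\tau^*}{\tau^*}$ on one-point (trivial) loops at $x$, for each $x\in X$, and, for $p\ge2$ and each $\xi\in X^p$, is $\frac1p\prod_{i\in\mathbb{Z}/p\mathbb{Z}}C_{\xi_i,\xi_{i+1}}e^{-\lambda_{\xi_i}\tau_i^*}d\tau_i^*$.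 The occupation field of a loop is $\widehat{l}^x=\sum_{i}1_{\{\xi_i=x\}}\tau_i^*$. *)

theory Defs
  imports "HOL-Analysis.Analysis"
begin

definition diag_matrix :: "real ^ 'n \<Rightarrow> real ^ 'n ^ 'n" where
  "diag_matrix d = (\<chi> x y. if x = y then d $ x else 0)"

definition total_rate :: "real ^ 'n ^ 'n \<Rightarrow> real ^ 'n \<Rightarrow> real ^ 'n::finite" where
  "total_rate C \<kappa> = (\<chi> x. \<kappa> $ x + (\<Sum>y\<in>UNIV. C $ x $ y))"

definition positive_definite :: "real ^ 'n ^ 'n::finite \<Rightarrow> bool" where
  "positive_definite A \<longleftrightarrow> transpose A = A \<and> (\<forall>v. v \<noteq> 0 \<longrightarrow> v \<bullet> (A *v v) > 0)"

(* The reflexive closure makes the (edgeless) one-point network irreducible. *)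
definition irreducible_conductances :: "real ^ 'n ^ 'n \<Rightarrow> bool" where
  "irreducible_conductances C \<longleftrightarrow> (\<forall>x y. (x, y) \<in> {(a, b). C $ a $ b > 0}\<^sup>*)"

definition green :: "real ^ 'n ^ 'n \<Rightarrow> real ^ 'n \<Rightarrow> real ^ 'n ^ 'n::finite" where
  "green C \<kappa> = matrix_inv (diag_matrix (total_rate C \<kappa>) - C)"

(* G_\<chi>; the letter \<chi> itself is the library's binder for vectors. *)
definition green_killed ::
    "real ^ 'n ^ 'n \<Rightarrow> real ^ 'n \<Rightarrow> real ^ 'n \<Rightarrow> real ^ 'n ^ 'n::finite" where
  "green_killed C \<kappa> chi =
     matrix_inv (diag_matrix (total_rate C \<kappa>) + diag_matrix chi - C)"

(* A based loop with p points is the list of the p pairs (\<xi>_i, \<tau>*_i), i = 0, ..., p - 1. *)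
definition based_loops :: "('n \<times> real) list set" where
  "based_loops = {b. b \<noteq> [] \<and> (\<forall>(x, t)\<in>set b. 0 < t)}"

definition mk_based_loop :: "'n list \<Rightarrow> (nat \<Rightarrow> real) \<Rightarrow> ('n \<times> real) list" where
  "mk_based_loop \<xi> \<tau> = zip \<xi> (map \<tau> [0..<length \<xi>])"

definition holding_times :: "nat \<Rightarrow> (nat \<Rightarrow> real) measure" where
  "holding_times p = (\<Pi>\<^sub>M i\<in>{..<p}. restrict_space lborel {0<..})"

definition loop_density ::
    "real ^ 'n ^ 'n \<Rightarrow> real ^ 'n \<Rightarrow> 'n::finite list \<Rightarrow> (nat \<Rightarrow> real) \<Rightarrow> real" where
  "loop_density C \<kappa> \<xi> \<tau> =
     (let lam = total_rate C \<kappa>; p = length \<xi> in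
      if p = 1 then exp (- (lam $ (\<xi> ! 0) * \<tau> 0)) / \<tau> 0
      else 1 / real p *
        (\<Prod>i<p. C $ (\<xi> ! i) $ (\<xi> ! ((i + 1) mod p)) * exp (- (lam $ (\<xi> ! i) * \<tau> i))))"

definition path_measure ::
    "real ^ 'n ^ 'n \<Rightarrow> real ^ 'n \<Rightarrow> 'n::finite list \<Rightarrow> (nat \<Rightarrow> real) measure" where
  "path_measure C \<kappa> \<xi> =
     density (holding_times (length \<xi>)) (\<lambda>\<tau>. ennreal (loop_density C \<kappa> \<xi> \<tau>))"

definition loop_section :: "'n list \<Rightarrow> ('n \<times> real) list set \<Rightarrow> (nat \<Rightarrow> real) set" where
  "loop_section \<xi> A = mk_based_loop \<xi> -` A \<inter> space (holding_times (length \<xi>))"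

(* The space of based loops is the disjoint union over \<xi> of the spaces (0,\<infinity>)^p; it carries
   the direct sum of their \<sigma>-algebras and of the measures above. *)
definition based_loop_sets :: "('n \<times> real) list set set" where
  "based_loop_sets = {A. A \<subseteq> based_loops \<and>
     (\<forall>\<xi>. \<xi> \<noteq> [] \<longrightarrow> loop_section \<xi> A \<in> sets (holding_times (length \<xi>)))}"

definition based_loop_measure ::
    "real ^ 'n ^ 'n \<Rightarrow> real ^ 'n \<Rightarrow> ('n::finite \<times> real) list measure" where
  "based_loop_measure C \<kappa> = measure_of based_loops based_loop_sets
     (\<lambda>A. \<integral>\<^sup>+\<xi>. emeasure (path_measure C \<kappa> \<xi>) (loop_section \<xi> A) \<partial>count_space {\<xi>. \<xi> \<noteq> []})"

definition rotation_rel :: "(('n \<times> real) list \<times> ('n \<times> real) list) set" where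
  "rotation_rel = {(b, b'). b \<in> based_loops \<and> (\<exists>k. b' = rotate k b)}"

definition loop_of :: "('n \<times> real) list \<Rightarrow> ('n \<times> real) list set" where
  "loop_of b = rotation_rel `` {b}"

definition loop_space :: "('n \<times> real) list set measure" where
  "loop_space = sigma (based_loops // rotation_rel)
     {L. L \<subseteq> based_loops // rotation_rel \<and> loop_of -` L \<inter> based_loops \<in> based_loop_sets}"

definition loop_measure ::
    "real ^ 'n ^ 'n \<Rightarrow> real ^ 'n \<Rightarrow> ('n::finite \<times> real) list set measure" where
  "loop_measure C \<kappa> = distr (based_loop_measure C \<kappa>) loop_space loop_of"

definition based_occupation :: "('n \<times> real) list \<Rightarrow> 'n \<Rightarrow> real" where
  "based_occupation b x = (\<Sum>i<length b. if fst (b ! i) = x then snd (b ! i) else 0)"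

definition occupation :: "('n \<times> real) list set \<Rightarrow> 'n \<Rightarrow> real" where
  "occupation l x = the_elem ((\<lambda>b. based_occupation b x) ` l)"

lemma based_loops_rotate: "rotate k b \<in> based_loops \<longleftrightarrow> b \<in> based_loops"
  by (simp add: based_loops_def)

lemma equiv_rotation_rel: "equiv based_loops rotation_rel"
proof (rule equivI)
  show "rotation_rel \<subseteq> based_loops \<times> based_loops"
    by (auto simp: rotation_rel_def based_loops_rotate)
  show "refl_on based_loops rotation_rel"
    by (auto simp: refl_on_def rotation_rel_def intro: exI[of _ 0])
  show "trans rotation_rel"
    unfolding trans_def rotation_rel_def by (auto simp: rotate_rotate)
  show "sym rotation_rel"
  proof (rule symI)
    fix b b' :: "('n \<times> real) list"
    assume "(b, b') \<in> rotation_rel"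
    then obtain k where b: "b \<in> based_loops" and b': "b' = rotate k b"
      by (auto simp: rotation_rel_def)
    define p where "p = length b"
    have "p > 0" using b by (auto simp: p_def based_loops_def)
    then have "(p - k mod p + k) mod p = 0"
      by (metis add.commute le_add_diff_inverse2 mod_add_right_eq mod_le_divisor mod_self)
    then have "rotate (p - k mod p) b' = b"
      unfolding b' rotate_rotate p_def by (metis rotate_id)
    then show "(b', b) \<in> rotation_rel"
      using b b' by (auto simp: rotation_rel_def based_loops_rotate intro!: exI[of _ "p - k mod p"])
  qed
qed

lemma based_occupation_eq_sum_list:
  "based_occupation b x = sum_list (map (\<lambda>(y, t). if y = x then t else 0) b)"
  by (simp add: based_occupation_def sum_list_sum_nth case_prod_beta atLeast0LessThan)

lemma based_occupation_rotate: "based_occupation (rotate k b) x = based_occupation b x"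
proof -
  have "based_occupation (rotate1 b) x = based_occupation b x" for b :: "('a \<times> real) list"
    by (cases b) (auto simp: based_occupation_eq_sum_list)
  then show ?thesis
    by (induction k) simp_all
qed

lemma occupation_loop_of:
  assumes "b \<in> based_loops"
  shows "occupation (loop_of b) x = based_occupation b x"
proof -
  have "loop_of b = range (\<lambda>k. rotate k b)"
    using assms by (auto simp: loop_of_def rotation_rel_def)
  then have "(\<lambda>b. based_occupation b x) ` loop_of b = {based_occupation b x}"
    by (simp add: image_image based_occupation_rotate)
  then show ?thesis by (simp add: occupation_def)
qed

lemma mk_based_loop_in_based_loops:
  assumes "\<xi> \<noteq> []" and "\<tau> \<in> space (holding_times (length \<xi>))"
  shows "mk_based_loop \<xi> \<tau> \<in> based_loops"
  using assms
  by (auto simp: mk_based_loop_def based_loops_def holding_times_def space_PiM PiE_def Pi_def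
      space_restrict_space in_set_zip)

lemma sigma_algebra_based_loop_sets: "sigma_algebra based_loops based_loop_sets"
proof -
  have compl: "loop_section \<xi> (based_loops - A) =
      space (holding_times (length \<xi>)) - loop_section \<xi> A" if "\<xi> \<noteq> []" for \<xi> :: "'n list" and A
    using mk_based_loop_in_based_loops[OF that] by (auto simp: loop_section_def)
  have Union: "loop_section \<xi> (\<Union>i. A i) = (\<Union>i. loop_section \<xi> (A i))"
    for \<xi> :: "'n list" and A :: "nat \<Rightarrow> _"
    by (auto simp: loop_section_def)
  show ?thesis
    unfolding sigma_algebra_iff2
    by (auto simp: based_loop_sets_def compl Union) (auto simp: loop_section_def)
qed

lemma space_based_loop_measure [simp]: "space (based_loop_measure C \<kappa>) = based_loops"
  unfolding based_loop_measure_def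
  by (rule space_measure_of) (auto simp: based_loop_sets_def)

lemma sets_based_loop_measure [simp]: "sets (based_loop_measure C \<kappa>) = based_loop_sets"
  unfolding based_loop_measure_def
  by (rule sigma_algebra.sets_measure_of_eq[OF sigma_algebra_based_loop_sets])

lemma emeasure_based_loop_measure:
  assumes "A \<in> based_loop_sets"
  shows "emeasure (based_loop_measure C \<kappa>) A =
    (\<integral>\<^sup>+\<xi>. emeasure (path_measure C \<kappa> \<xi>) (loop_section \<xi> A) \<partial>count_space {\<xi>. \<xi> \<noteq> []})"
proof -
  let ?\<mu> = "\<lambda>A. \<integral>\<^sup>+\<xi>. emeasure (path_measure C \<kappa> \<xi>) (loop_section \<xi> A) \<partial>count_space {\<xi>. \<xi> \<noteq> []}"
  have "countably_additive based_loop_sets ?\<mu>"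
  proof (rule countably_additiveI)
    fix A :: "nat \<Rightarrow> ('a \<times> real) list set"
    assume A: "range A \<subseteq> based_loop_sets" and disj: "disjoint_family A"
    have "(\<Sum>i. ?\<mu> (A i)) =
        (\<integral>\<^sup>+\<xi>. (\<Sum>i. emeasure (path_measure C \<kappa> \<xi>) (loop_section \<xi> (A i))) \<partial>count_space {\<xi>. \<xi> \<noteq> []})"
      by (subst nn_integral_suminf) auto
    also have "\<dots> = ?\<mu> (\<Union>i. A i)"
    proof (rule nn_integral_cong)
      fix \<xi> :: "'a list" assume "\<xi> \<in> space (count_space {\<xi>. \<xi> \<noteq> []})"
      then have "range (\<lambda>i. loop_section \<xi> (A i)) \<subseteq> sets (path_measure C \<kappa> \<xi>)"
        using A by (auto simp: based_loop_sets_def path_measure_def)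
      moreover have "disjoint_family (\<lambda>i. loop_section \<xi> (A i))"
        using disj by (fastforce simp: disjoint_family_on_def loop_section_def)
      moreover have "(\<Union>i. loop_section \<xi> (A i)) = loop_section \<xi> (\<Union>i. A i)"
        by (auto simp: loop_section_def)
      ultimately show "(\<Sum>i. emeasure (path_measure C \<kappa> \<xi>) (loop_section \<xi> (A i))) =
          emeasure (path_measure C \<kappa> \<xi>) (loop_section \<xi> (\<Union>i. A i))"
        by (simp add: suminf_emeasure)
    qed
    finally show "(\<Sum>i. ?\<mu> (A i)) = ?\<mu> (\<Union>i. A i)" .
  qed
  moreover have "positive based_loop_sets ?\<mu>"
    by (simp add: positive_def loop_section_def)
  ultimately show ?thesis
    unfolding based_loop_measure_def
    using assms sigma_algebra_based_loop_sets by (intro emeasure_measure_of_sigma)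
qed

lemma loop_of_measurable: "loop_of \<in> measurable (based_loop_measure C \<kappa>) loop_space"
  unfolding loop_space_def
  by (rule measurable_measure_of) (auto simp: loop_of_def quotientI)

end

theory Submission
  imports Defs
begin

text \<open>
  Write \<open>\<lambda>\<close> for the total rates. Integrating out the holding times turns the loop measure into a
  sum over discrete closed paths. For a path of length at least two, the holding times are
  independent exponentials, and inserting the factor \<open>exp (- \<langle>l, \<chi>\<rangle>)\<close> only replaces each rate
  \<open>\<lambda>\<close> by \<open>\<lambda> + \<chi>\<close>. So the mass of \<open>1 - exp (- \<langle>l, \<chi>\<rangle>)\<close> over paths of length \<open>p\<close> is
  \<open>(tr P\<^sup>p - tr Q\<^sup>p) / p\<close>, where \<open>P\<close> and \<open>Q\<close> are the jump matrices \<open>C / \<lambda>\<close> and \<open>C / (\<lambda> + \<chi>)\<close>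
  (\<open>nn_integral_loops_through\<close>, \<open>sum_cyclic_prod_eq_trace\<close>). The one-point loops contribute the
  Frullani integrals \<open>ln ((\<lambda>\<^sub>x + \<chi>\<^sub>x) / \<lambda>\<^sub>x)\<close> (\<open>nn_integral_frullani\<close>), and these are exactly the diagonal
  factors that separate \<open>det (I - P)\<close> from \<open>det (M - C)\<close>, \<open>M\<close> being the diagonal matrix of rates.
  Summed over \<open>p\<close>, everything becomes \<open>ln (det (M\<^sub>\<lambda> + M\<^sub>\<chi> - C) / det (M\<^sub>\<lambda> - C))\<close>; the three
  determinants of the theorem are this quotient or its inverse, by multiplicativity of \<open>det\<close>.

  The series \<open>\<Sum>p. tr P\<^sup>p / p = - ln (det (I - P))\<close> is where the mass gap enters. The matrix \<open>P\<close> is only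
  substochastic, so the naive bounds give convergence of \<open>\<Sum>p. s\<^sup>p tr P\<^sup>p / p\<close> merely for \<open>\<bar>s\<bar> < 1\<close>.
  There the Neumann series inverts \<open>I - s P\<close>, and Jacobi's formula for the derivative of a
  determinant shows that \<open>det (I - s P)\<close> times the exponential of the series is constant.
  Because all the traces are nonnegative, letting \<open>s\<close> increase to 1 is legitimate as soon as \<open>det (I - P) \<noteq> 0\<close> (\<open>log_det_trace_series\<close>), which follows from positive
  definiteness.

  The integrand \<open>1 - exp (- \<langle>l, \<chi>\<rangle>)\<close> is nonnegative, so the exchanges of sums and integrals happen
  in the extended nonnegative reals, although the loop measure itself is infinite; integrability
  is a consequence of the finite value.
\<close>

section \<open>Matrix powers and determinants\<close>

primrec matrix_pow :: "'a::semiring_1 ^ 'n ^ 'n \<Rightarrow> nat \<Rightarrow> 'a ^ 'n ^ 'n" where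
  "matrix_pow A 0 = mat 1"
| "matrix_pow A (Suc k) = A ** matrix_pow A k"

lemma matrix_add_rdistrib:
  fixes A :: "real ^ 'n ^ 'm" shows "(A + B) ** C = A ** C + B ** C"
  by (simp add: vec_eq_iff matrix_matrix_mult_def distrib_right sum.distrib)

lemma matrix_diff_ldistrib:
  fixes A :: "real ^ 'n ^ 'm" shows "A ** (B - C) = A ** B - A ** C"
  by (simp add: vec_eq_iff matrix_matrix_mult_def right_diff_distrib sum_subtractf)

lemma matrix_diff_rdistrib:
  fixes A :: "real ^ 'n ^ 'm" shows "(A - B) ** C = A ** C - B ** C"
  by (simp add: vec_eq_iff matrix_matrix_mult_def left_diff_distrib sum_subtractf)

lemma matrix_inv_mult:
  fixes A :: "real ^ 'n::finite ^ 'n"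
  assumes "det A \<noteq> 0"
  shows "matrix_inv A ** A = mat 1" "A ** matrix_inv A = mat 1"
proof -
  have "\<exists>A'. A ** A' = mat 1 \<and> A' ** A = mat 1"
    using assms by (simp add: invertible_det_nz[symmetric] invertible_def)
  then have "A ** matrix_inv A = mat 1 \<and> matrix_inv A ** A = mat 1"
    unfolding matrix_inv_def by (rule someI_ex)
  then show "matrix_inv A ** A = mat 1" "A ** matrix_inv A = mat 1" by auto
qed

text \<open>
  Jacobi's formula at the identity: in the Leibniz expansion, a permutation other than the
  identity moves at least two points, so its product has at least two vanishing factors at
  \<open>h = 0\<close> and no first-order term.
\<close>

lemma det_mat_1_plus_has_derivative:
  fixes B :: "real ^ 'n ^ 'n"
  shows "((\<lambda>h. det (mat 1 + h *\<^sub>R B)) has_real_derivative trace B) (at 0)"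
proof -
  have entry: "((\<lambda>h. (mat 1 + h *\<^sub>R B) $ i $ j) has_real_derivative B $ i $ j) (at 0)" for i j
    by (auto intro!: derivative_eq_intros)
  define D where "D p = (\<Sum>i\<in>UNIV. B $ i $ p i *
      (\<Prod>j\<in>UNIV - {i}. (mat 1 + 0 *\<^sub>R B) $ j $ p j))" for p :: "'n \<Rightarrow> 'n"
  have D: "((\<lambda>h. \<Prod>i\<in>UNIV. (mat 1 + h *\<^sub>R B) $ i $ p i) has_real_derivative D p) (at 0)" for p
    unfolding D_def by (rule has_field_derivative_prod) (rule entry)
  have D_id: "D id = trace B"
    by (simp add: D_def trace_def mat_def)
  have D_other: "D p = 0" if p: "p permutes UNIV" and "p \<noteq> id" for p
  proof -
    obtain j where j: "p j \<noteq> j" using \<open>p \<noteq> id\<close> by (auto simp: fun_eq_iff)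
    have ppj: "p (p j) \<noteq> p j" using p j by (metis permutes_inverses(2))
    have "(\<Prod>l\<in>UNIV - {i}. (mat 1 + 0 *\<^sub>R B) $ l $ p l) = 0" for i
    proof (cases "i = j")
      case True
      then show ?thesis using j ppj by (intro prod_zero) (auto simp: mat_def intro!: bexI[of _ "p j"])
    next
      case False
      then show ?thesis using j by (intro prod_zero) (auto simp: mat_def intro!: bexI[of _ j])
    qed
    then show ?thesis unfolding D_def by (simp only: mult_zero_right sum.neutral_const)
  qed
  have "((\<lambda>h. det (mat 1 + h *\<^sub>R B)) has_real_derivative
      (\<Sum>p\<in>{p. p permutes UNIV}. of_int (sign p) * D p)) (at 0)"
    unfolding det_def by (intro DERIV_sum DERIV_cmult D)
  also have "(\<Sum>p\<in>{p. p permutes (UNIV :: 'n set)}. of_int (sign p) * D p) =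
      (\<Sum>p\<in>{id}. of_int (sign p) * D p)"
    by (rule sum.mono_neutral_right) (auto simp: D_other permutes_id)
  finally show ?thesis by (simp add: D_id sign_id)
qed

lemma positive_definite_imp_det_nonzero:
  fixes A :: "real ^ 'n::finite ^ 'n"
  assumes "positive_definite A"
  shows "det A \<noteq> 0"
proof -
  have "v = 0" if "A *v v = 0" for v
    using assms that by (force simp: positive_definite_def)
  then have "invertible A"
    by (simp add: invertible_left_inverse matrix_left_invertible_ker)
  then show ?thesis by (simp add: invertible_det_nz)
qed

lemma positive_definite_add_diag_matrix:
  fixes A :: "real ^ 'n::finite ^ 'n"
  assumes "positive_definite A" and "\<And>x. 0 \<le> d $ x"
  shows "positive_definite (A + diag_matrix d)"
proof -
  have "diag_matrix d *v v = (\<chi> x. d $ x * v $ x)" for v :: "real ^ 'n"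
    by (simp add: diag_matrix_def matrix_vector_mult_def vec_eq_iff if_distrib[of "\<lambda>c. c * _"] cong: if_cong)
  then have "v \<bullet> (diag_matrix d *v v) = (\<Sum>x\<in>UNIV. d $ x * (v $ x)\<^sup>2)" for v :: "real ^ 'n"
    by (simp add: inner_vec_def power2_eq_square mult_ac)
  then have "0 \<le> v \<bullet> (diag_matrix d *v v)" for v :: "real ^ 'n"
    using assms(2) by (simp add: sum_nonneg)
  moreover have "transpose (diag_matrix d) = diag_matrix d"
    by (simp add: diag_matrix_def transpose_def vec_eq_iff)
  then have "transpose (A + diag_matrix d) = A + diag_matrix d"
    using assms(1) by (simp add: positive_definite_def transpose_def vec_eq_iff)
  ultimately show ?thesis
    using assms(1) by (auto simp: positive_definite_def matrix_vector_mult_add_rdistrib inner_add_right add_pos_nonneg)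
qed

section \<open>The logarithm of a determinant as a series of traces\<close>

lemma matrix_pow_substochastic:
  fixes P :: "real ^ 'n::finite ^ 'n"
  assumes nonneg: "\<And>x y. 0 \<le> P $ x $ y" and rows: "\<And>x. (\<Sum>y\<in>UNIV. P $ x $ y) \<le> 1"
  shows "0 \<le> matrix_pow P k $ x $ y" and "matrix_pow P k $ x $ y \<le> 1"
proof -
  have "0 \<le> matrix_pow P k $ x $ y \<and> matrix_pow P k $ x $ y \<le> 1"
  proof (induction k arbitrary: x y)
    case 0
    then show ?case by (simp add: mat_def)
  next
    case (Suc k)
    have "(\<Sum>z\<in>UNIV. P $ x $ z * matrix_pow P k $ z $ y) \<le> (\<Sum>z\<in>UNIV. P $ x $ z * 1)"
      using Suc nonneg by (intro sum_mono mult_left_mono) auto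
    moreover have "0 \<le> (\<Sum>z\<in>UNIV. P $ x $ z * matrix_pow P k $ z $ y)"
      using Suc nonneg by (intro sum_nonneg mult_nonneg_nonneg) auto
    ultimately show ?case using rows[of x] by (simp add: matrix_matrix_mult_def)
  qed
  then show "0 \<le> matrix_pow P k $ x $ y" "matrix_pow P k $ x $ y \<le> 1" by auto
qed

text \<open>
  The entries of the powers of a substochastic matrix stay in the unit interval, so the
  Neumann series converges entrywise. It supplies both the inverse of \<open>I - s P\<close> and the expansion of
  the trace that Jacobi's formula calls for.
\<close>

lemma neumann_series:
  fixes P :: "real ^ 'n::finite ^ 'n"
  assumes nonneg: "\<And>x y. 0 \<le> P $ x $ y" and rows: "\<And>x. (\<Sum>y\<in>UNIV. P $ x $ y) \<le> 1"
    and s: "\<bar>s\<bar> < 1"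
  obtains N where "N ** (mat 1 - s *\<^sub>R P) = mat 1"
    and "(\<lambda>k. s ^ k * trace (matrix_pow P (Suc k))) sums trace (P ** N)"
proof -
  define N :: "real ^ 'n ^ 'n" where "N = (\<chi> x y. \<Sum>k. s ^ k * matrix_pow P k $ x $ y)"
  have N_sums: "(\<lambda>k. s ^ k * matrix_pow P k $ x $ y) sums (N $ x $ y)" for x y
  proof -
    have "summable (\<lambda>k. s ^ k * matrix_pow P k $ x $ y)"
    proof (rule summable_comparison_test')
      show "summable (\<lambda>k. \<bar>s\<bar> ^ k)" using s by (simp add: summable_geometric)
      show "norm (s ^ k * matrix_pow P k $ x $ y) \<le> \<bar>s\<bar> ^ k" for k
        using matrix_pow_substochastic[OF nonneg rows, of k x y]
        by (auto simp: abs_mult power_abs intro!: mult_left_le)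
    qed
    then show ?thesis by (simp add: N_def summable_sums)
  qed
  have PN_sums: "(\<lambda>k. s ^ k * matrix_pow P (Suc k) $ x $ y) sums ((P ** N) $ x $ y)" for x y
  proof -
    have "(\<lambda>k. \<Sum>z\<in>UNIV. P $ x $ z * (s ^ k * matrix_pow P k $ z $ y)) sums
        (\<Sum>z\<in>UNIV. P $ x $ z * N $ z $ y)"
      by (intro sums_sum sums_mult N_sums)
    then show ?thesis
      by (simp add: matrix_matrix_mult_def sum_distrib_left mult_ac)
  qed
  have "N $ x $ y = s * (P ** N) $ x $ y + mat 1 $ x $ y" for x y
  proof -
    have "(\<lambda>k. s ^ Suc k * matrix_pow P (Suc k) $ x $ y) sums (s * (P ** N) $ x $ y)"
      using sums_mult[OF PN_sums, of s x y] by (simp add: mult_ac)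
    from sums_Suc[OF this] N_sums[of x y] show ?thesis
      by (simp add: sums_unique2)
  qed
  then have "(mat 1 - s *\<^sub>R P) ** N = mat 1"
    by (simp add: vec_eq_iff matrix_diff_rdistrib scalar_matrix_assoc[symmetric])
  then have "N ** (mat 1 - s *\<^sub>R P) = mat 1" by (simp add: matrix_left_right_inverse)
  moreover have "(\<lambda>k. s ^ k * trace (matrix_pow P (Suc k))) sums trace (P ** N)"
    using sums_sum[of UNIV, OF PN_sums] by (simp add: trace_def sum_distrib_left)
  ultimately show thesis by (rule that)
qed

text \<open>
  The product of \<open>det (I - s P)\<close> and \<open>exp (\<Sum>k. tr P\<^sup>k s\<^sup>k / k)\<close> has derivative zero on \<open>(-1, 1)\<close> and
  equals 1 at 0. Working with this product rather than with the logarithm of the determinant gives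
  the positivity of \<open>det (I - s P)\<close> for free. At \<open>k = 0\<close> the coefficient is a division by zero, hence 0.
\<close>

lemma det_eq_exp_trace_series:
  fixes P :: "real ^ 'n::finite ^ 'n"
  assumes nonneg: "\<And>x y. 0 \<le> P $ x $ y" and rows: "\<And>x. (\<Sum>y\<in>UNIV. P $ x $ y) \<le> 1"
    and s: "\<bar>s\<bar> < 1"
  shows "det (mat 1 - s *\<^sub>R P) = exp (- (\<Sum>k. trace (matrix_pow P k) / real k * s ^ k))"
    and "summable (\<lambda>k. trace (matrix_pow P k) / real k * s ^ k)"
proof -
  define c where "c k = trace (matrix_pow P k) / real k" for k
  define F where "F s = (\<Sum>k. c k * s ^ k)" for s
  have diffs_c: "diffs c k = trace (matrix_pow P (Suc k))" for k
    by (simp add: diffs_def c_def)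
  have trace_bounds: "0 \<le> trace (matrix_pow P k)" "trace (matrix_pow P k) \<le> CARD('n)" for k
    using matrix_pow_substochastic[OF nonneg rows, of k]
      sum_mono[of UNIV "\<lambda>i. matrix_pow P k $ i $ i" "\<lambda>_. 1"]
    by (auto simp: trace_def intro!: sum_nonneg)
  have summable: "summable (\<lambda>k. c k * r ^ k)" if "norm r < 1" for r
  proof (rule summable_comparison_test')
    show "summable (\<lambda>k. real CARD('n) * \<bar>r\<bar> ^ k)" using that by (simp add: summable_geometric)
    show "norm (c k * r ^ k) \<le> real CARD('n) * \<bar>r\<bar> ^ k" for k
    proof -
      have "\<bar>c k\<bar> \<le> real CARD('n)"
      proof (cases "k = 0")
        case False
        then have "c k \<le> trace (matrix_pow P k) / 1"
          unfolding c_def using trace_bounds by (intro divide_left_mono) auto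
        then show ?thesis using trace_bounds[of k] by (simp add: c_def)
      qed (simp add: c_def)
      then show ?thesis by (auto simp: abs_mult power_abs intro: mult_right_mono)
    qed
  qed
  have deriv_0: "((\<lambda>r. det (mat 1 - r *\<^sub>R P) * exp (F r)) has_real_derivative 0) (at r)" if r: "\<bar>r\<bar> < 1" for r
  proof -
    obtain N where N: "N ** (mat 1 - r *\<^sub>R P) = mat 1"
      and tr: "(\<lambda>k. r ^ k * trace (matrix_pow P (Suc k))) sums trace (P ** N)"
      using neumann_series[OF nonneg rows r] by blast
    \<comment> \<open>Recentring at r reduces the derivative at r to the one at the identity.\<close>
    have split: "det (mat 1 - q *\<^sub>R P) =
        det (mat 1 - r *\<^sub>R P) * det (mat 1 + (r - q) *\<^sub>R (P ** N))" for q
    proof -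
      have "(mat 1 + (r - q) *\<^sub>R (P ** N)) ** (mat 1 - r *\<^sub>R P) =
          (mat 1 - r *\<^sub>R P) + (r - q) *\<^sub>R (P ** (N ** (mat 1 - r *\<^sub>R P)))"
        by (simp add: matrix_add_rdistrib scalar_matrix_assoc[symmetric] matrix_mul_assoc)
      also have "\<dots> = mat 1 - q *\<^sub>R P" by (simp add: N algebra_simps)
      finally show ?thesis by (metis det_mul mult.commute)
    qed
    have factor': "((\<lambda>q. det (mat 1 + (r - q) *\<^sub>R (P ** N))) has_real_derivative trace (P ** N) * (- 1)) (at r)"
      by (rule DERIV_chain2[where g = "\<lambda>q. r - q"])
        (auto intro!: det_mat_1_plus_has_derivative derivative_eq_intros)
    have det': "((\<lambda>q. det (mat 1 - q *\<^sub>R P)) has_real_derivative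
        det (mat 1 - r *\<^sub>R P) * (- trace (P ** N))) (at r)"
      using DERIV_cmult[OF factor', of "det (mat 1 - r *\<^sub>R P)"]
      by (simp only: split[symmetric] mult_minus1_right)
    have "(F has_real_derivative (\<Sum>k. diffs c k * r ^ k)) (at r)"
      unfolding F_def using r by (intro termdiffs_strong'[where K = 1] summable) auto
    moreover have "(\<Sum>k. diffs c k * r ^ k) = trace (P ** N)"
      using tr by (simp add: diffs_c sums_iff mult.commute)
    ultimately have F': "(F has_real_derivative trace (P ** N)) (at r)" by simp
    have "((\<lambda>q. exp (F q)) has_real_derivative exp (F r) * trace (P ** N)) (at r)"
      by (rule DERIV_chain2[OF DERIV_exp F'])
    from DERIV_mult[OF det' this] show ?thesis by (simp add: mult_ac)
  qed
  have "\<exists>a. \<forall>r\<in>{-1<..<1}. det (mat 1 - r *\<^sub>R P) * exp (F r) = a"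
  proof (rule has_field_derivative_zero_constant)
    fix r :: real assume "r \<in> {-1<..<1}"
    then have "\<bar>r\<bar> < 1" by auto
    from deriv_0[OF this]
    show "((\<lambda>r. det (mat 1 - r *\<^sub>R P) * exp (F r)) has_real_derivative 0) (at r within {-1<..<1})"
      by (rule has_field_derivative_at_within)
  qed simp
  then obtain a where a: "\<forall>r\<in>{-1<..<1}. det (mat 1 - r *\<^sub>R P) * exp (F r) = a" ..
  have const: "det (mat 1 - r *\<^sub>R P) * exp (F r) = a" if "\<bar>r\<bar> < 1" for r
    using a that by (simp add: abs_less_iff)
  moreover have "det (mat 1 - 0 *\<^sub>R P) * exp (F 0) = 1"
    using powser_zero[of c] by (simp add: F_def) (simp add: c_def)
  ultimately have "det (mat 1 - s *\<^sub>R P) * exp (F s) = 1"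
    using const[of 0] const[OF s] by simp
  then show "det (mat 1 - s *\<^sub>R P) = exp (- (\<Sum>k. trace (matrix_pow P k) / real k * s ^ k))"
    by (simp add: F_def c_def exp_minus field_simps)
  show "summable (\<lambda>k. trace (matrix_pow P k) / real k * s ^ k)"
    using summable[of s] s by (simp add: c_def)
qed

text \<open>
  The boundary case \<open>s = 1\<close> of the previous identity. The coefficients are nonnegative, so partial
  sums at 1 are bounded by the limit of the power series as \<open>s\<close> increases to 1, and conversely the
  power series is bounded by its value at 1. The hypothesis on the determinant keeps that limit
  finite; it cannot be dropped, as a stochastic matrix shows.
\<close>

lemma log_det_trace_series:
  fixes P :: "real ^ 'n::finite ^ 'n"
  assumes nonneg: "\<And>x y. 0 \<le> P $ x $ y" and rows: "\<And>x. (\<Sum>y\<in>UNIV. P $ x $ y) \<le> 1"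
    and det: "det (mat 1 - P) \<noteq> 0"
  shows "0 < det (mat 1 - P)"
    and "(\<lambda>k. trace (matrix_pow P k) / real k) sums - ln (det (mat 1 - P))"
proof -
  define c where "c k = trace (matrix_pow P k) / real k" for k
  have c_nonneg: "0 \<le> c k" for k
    using matrix_pow_substochastic[OF nonneg rows, of k] by (auto simp: c_def trace_def intro!: sum_nonneg divide_nonneg_nonneg)
  define F where "F s = (\<Sum>k. c k * s ^ k)" for s
  have exp_F: "det (mat 1 - s *\<^sub>R P) = exp (- F s)" and summable: "summable (\<lambda>k. c k * s ^ k)"
    if "\<bar>s\<bar> < 1" for s
    using det_eq_exp_trace_series[OF nonneg rows that] by (simp_all add: F_def c_def)
  have near: "eventually (\<lambda>s::real. s \<in> {0<..<1}) (at_left 1)"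
    by (rule eventually_at_left_real) simp
  have "((\<lambda>s. det (mat 1 - s *\<^sub>R P)) \<longlongrightarrow> det (mat 1 - 1 *\<^sub>R P)) (at_left 1)"
    unfolding det_def by (intro tendsto_intros)
  then have lim: "((\<lambda>s. det (mat 1 - s *\<^sub>R P)) \<longlongrightarrow> det (mat 1 - P)) (at_left 1)" by simp
  have "0 \<le> det (mat 1 - P)"
    by (rule tendsto_lowerbound[OF lim eventually_mono[OF near]]) (auto simp: exp_F)
  with det show pos: "0 < det (mat 1 - P)" by simp
  have "((\<lambda>s. - ln (det (mat 1 - s *\<^sub>R P))) \<longlongrightarrow> - ln (det (mat 1 - P))) (at_left 1)"
    using pos by (intro tendsto_intros lim) auto
  moreover have "eventually (\<lambda>s. - ln (det (mat 1 - s *\<^sub>R P)) = F s) (at_left 1)"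
    by (rule eventually_mono[OF near]) (simp add: exp_F)
  ultimately have F_lim: "(F \<longlongrightarrow> - ln (det (mat 1 - P))) (at_left 1)"
    by (rule Lim_transform_eventually)
  have partial: "(\<Sum>k<n. c k) \<le> - ln (det (mat 1 - P))" for n
  proof (rule tendsto_le[OF _ F_lim])
    show "((\<lambda>s. \<Sum>k<n. c k * s ^ k) \<longlongrightarrow> (\<Sum>k<n. c k)) (at_left 1)"
      by (auto intro!: tendsto_eq_intros)
    show "eventually (\<lambda>s. (\<Sum>k<n. c k * s ^ k) \<le> F s) (at_left 1)"
      by (rule eventually_mono[OF near])
        (auto simp: F_def c_nonneg intro!: sum_le_suminf summable)
  qed simp
  have sum_c: "summable c"
    by (rule summableI_nonneg_bounded[OF c_nonneg partial])
  have "suminf c \<le> - ln (det (mat 1 - P))"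
    by (rule suminf_le_const[OF sum_c partial])
  moreover have "- ln (det (mat 1 - P)) \<le> suminf c"
  proof (rule tendsto_upperbound[OF F_lim eventually_mono[OF near]])
    show "F s \<le> suminf c" if "s \<in> {0<..<1}" for s
      unfolding F_def using that
      by (intro suminf_le summable sum_c) (auto intro!: mult_left_le c_nonneg power_le_one)
  qed simp
  ultimately show "(\<lambda>k. trace (matrix_pow P k) / real k) sums - ln (det (mat 1 - P))"
    using sum_c by (simp add: sums_iff c_def[abs_def])
qed

text \<open>
  The transition matrix of the embedded chain with holding rates \<open>r\<close>. It is substochastic if \<open>r\<close>
  is at least the total conductance at each point, the defect being the killing probability.
\<close>

definition jump_matrix :: "real ^ 'n ^ 'n \<Rightarrow> real ^ 'n \<Rightarrow> real ^ 'n ^ 'n" where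
  "jump_matrix C r = (\<chi> x y. C $ x $ y / r $ x)"

lemma jump_matrix_trace_series:
  fixes C :: "real ^ 'n::finite ^ 'n"
  assumes C: "\<And>x y. 0 \<le> C $ x $ y" and r: "\<And>x. 0 < r $ x"
    and rows: "\<And>x. (\<Sum>y\<in>UNIV. C $ x $ y) \<le> r $ x"
    and det: "det (diag_matrix r - C) \<noteq> 0"
  shows "0 < det (diag_matrix r - C)"
    and "(\<lambda>k. trace (matrix_pow (jump_matrix C r) k) / real k) sums
      ((\<Sum>x\<in>UNIV. ln (r $ x)) - ln (det (diag_matrix r - C)))"
proof -
  let ?P = "jump_matrix C r"
  have "(diag_matrix r ** ?P) $ x $ y = r $ x * ?P $ x $ y" for x y
    by (simp add: diag_matrix_def matrix_matrix_mult_def if_distrib[of "\<lambda>c. c * _"] cong: if_cong)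
  then have "diag_matrix r ** ?P = C"
    using r[THEN less_imp_neq, symmetric] by (simp add: vec_eq_iff jump_matrix_def)
  then have "diag_matrix r - C = diag_matrix r ** (mat 1 - ?P)"
    by (simp add: matrix_diff_ldistrib)
  moreover have "det (diag_matrix r) = (\<Prod>x\<in>UNIV. r $ x)"
    by (subst det_diagonal) (auto simp: diag_matrix_def)
  ultimately have factor: "det (diag_matrix r - C) = (\<Prod>x\<in>UNIV. r $ x) * det (mat 1 - ?P)"
    by (simp add: det_mul)
  have prod_pos: "0 < (\<Prod>x\<in>UNIV. r $ x)" using r by (intro prod_pos) auto
  have nonneg: "0 \<le> ?P $ x $ y" for x y
    using C r[of x] by (simp add: jump_matrix_def)
  have rows1: "(\<Sum>y\<in>UNIV. ?P $ x $ y) \<le> 1" for x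
    using rows[of x] r[of x] by (simp add: jump_matrix_def sum_divide_distrib[symmetric])
  have nz: "det (mat 1 - ?P) \<noteq> 0" using det by (simp add: factor)
  note series = log_det_trace_series[OF nonneg rows1 nz]
  show "0 < det (diag_matrix r - C)"
    using series(1) prod_pos by (simp add: factor)
  have "- ln (det (mat 1 - ?P)) = (\<Sum>x\<in>UNIV. ln (r $ x)) - ln (det (diag_matrix r - C))"
    using series(1) prod_pos r by (simp add: factor ln_mult ln_prod less_imp_neq[symmetric])
  then show "(\<lambda>k. trace (matrix_pow ?P k) / real k) sums
      ((\<Sum>x\<in>UNIV. ln (r $ x)) - ln (det (diag_matrix r - C)))"
    using series(2) by simp
qed

section \<open>Closed paths and traces\<close>

text \<open>
  The list holds the intermediate points only. Keeping the two end points apart makes the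
  recursion match that of matrix powers; closing the path later amounts to equating them.
\<close>

primrec path_weight :: "real ^ 'n ^ 'n \<Rightarrow> 'n \<Rightarrow> 'n list \<Rightarrow> 'n \<Rightarrow> real" where
  "path_weight A x [] y = A $ x $ y"
| "path_weight A x (z # \<zeta>) y = A $ x $ z * path_weight A z \<zeta> y"

lemma sum_lists_length_Suc:
  fixes f :: "'n::finite list \<Rightarrow> real"
  shows "(\<Sum>\<xi> | length \<xi> = Suc k. f \<xi>) = (\<Sum>x\<in>UNIV. \<Sum>\<zeta> | length \<zeta> = k. f (x # \<zeta>))"
proof -
  have "(\<Sum>\<xi> | length \<xi> = Suc k. f \<xi>) = (\<Sum>(x, \<zeta>)\<in>UNIV \<times> {\<zeta>. length \<zeta> = k}. f (x # \<zeta>))"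
    by (rule sum.reindex_bij_witness[of _ "\<lambda>(x, \<zeta>). x # \<zeta>" "\<lambda>\<xi>. (hd \<xi>, tl \<xi>)"])
      (auto simp: length_Suc_conv)
  then show ?thesis by (simp add: sum.cartesian_product)
qed

lemma sum_path_weight:
  "(\<Sum>\<zeta> | length \<zeta> = k. path_weight A x \<zeta> y) = matrix_pow A (Suc k) $ x $ (y :: 'n::finite)"
proof (induction k arbitrary: x)
  case 0
  then show ?case by simp
next
  case (Suc k)
  have "(\<Sum>\<zeta> | length \<zeta> = Suc k. path_weight A x \<zeta> y) =
      (\<Sum>z\<in>UNIV. A $ x $ z * matrix_pow A (Suc k) $ z $ y)"
    by (simp add: sum_lists_length_Suc Suc.IH sum_distrib_left[symmetric] del: matrix_pow.simps)
  then show ?case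
    by (simp add: matrix_matrix_mult_def)
qed

lemma path_weight_eq_prod:
  "path_weight A x \<zeta> y = (\<Prod>i<Suc (length \<zeta>). A $ ((x # \<zeta>) ! i) $ ((\<zeta> @ [y]) ! i))"
proof (induction \<zeta> arbitrary: x)
  case (Cons z \<zeta>)
  then show ?case by (subst prod.lessThan_Suc_shift) (simp del: prod.lessThan_Suc)
qed simp

lemma sum_cyclic_prod_eq_trace:
  fixes A :: "real ^ 'n::finite ^ 'n"
  assumes "0 < p"
  shows "(\<Sum>\<xi> | length \<xi> = p. \<Prod>i<p. A $ (\<xi> ! i) $ (\<xi> ! ((i + 1) mod p))) = trace (matrix_pow A p)"
proof -
  obtain k where p: "p = Suc k" using assms by (cases p) auto
  have cyc: "(\<Prod>i<p. A $ ((x # \<zeta>) ! i) $ ((x # \<zeta>) ! ((i + 1) mod p))) = path_weight A x \<zeta> x"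
    if "length \<zeta> = k" for x \<zeta>
    unfolding path_weight_eq_prod p using that
    by (intro prod.cong) (auto simp: nth_append less_Suc_eq mod_Suc)
  have "(\<Sum>\<xi> | length \<xi> = p. \<Prod>i<p. A $ (\<xi> ! i) $ (\<xi> ! ((i + 1) mod p))) =
      (\<Sum>x\<in>UNIV. \<Sum>\<zeta> | length \<zeta> = k. path_weight A x \<zeta> x)"
    by (subst p, subst sum_lists_length_Suc, intro sum.cong) (simp_all only: cyc mem_Collect_eq)
  also have "\<dots> = trace (matrix_pow A p)"
    by (simp only: sum_path_weight p trace_def)
  finally show ?thesis .
qed

text \<open>
  Lists over a finite alphabet are graded by length into finite classes, so the integral over
  discrete loops becomes a series of finite sums.
\<close>

lemma nn_integral_nonempty_lists_by_length:
  fixes f :: "'n::finite list \<Rightarrow> ennreal"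
  shows "(\<integral>\<^sup>+\<xi>. f \<xi> \<partial>count_space {\<xi>. \<xi> \<noteq> []}) = (\<Sum>k. \<Sum>\<xi> | length \<xi> = Suc k. f \<xi>)"
proof -
  have "f \<xi> = (\<Sum>k. f \<xi> * indicator {\<xi>. length \<xi> = Suc k} \<xi>)" if "\<xi> \<noteq> []" for \<xi>
  proof -
    have "(\<Sum>k. f \<xi> * indicator {\<xi>. length \<xi> = Suc k} \<xi>) =
        (\<Sum>k\<in>{length \<xi> - 1}. f \<xi> * indicator {\<xi>. length \<xi> = Suc k} \<xi>)"
      using that by (intro suminf_finite) (auto simp: indicator_def)
    then show ?thesis using that by simp
  qed
  then have "(\<integral>\<^sup>+\<xi>. f \<xi> \<partial>count_space {\<xi>. \<xi> \<noteq> []}) =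
      (\<integral>\<^sup>+\<xi>. (\<Sum>k. f \<xi> * indicator {\<xi>. length \<xi> = Suc k} \<xi>) \<partial>count_space {\<xi>. \<xi> \<noteq> []})"
    by (intro nn_integral_cong) auto
  also have "\<dots> = (\<Sum>k. \<integral>\<^sup>+\<xi>. f \<xi> * indicator {\<xi>. length \<xi> = Suc k} \<xi> \<partial>count_space {\<xi>. \<xi> \<noteq> []})"
    by (rule nn_integral_suminf) simp
  also have "\<dots> = (\<Sum>k. \<Sum>\<xi> | length \<xi> = Suc k. f \<xi>)"
  proof (rule suminf_cong)
    fix k
    have "finite {\<xi> :: 'n list. length \<xi> = Suc k}"
      using finite_lists_length_eq[of "UNIV :: 'n set" "Suc k"] by simp
    then have "(\<integral>\<^sup>+\<xi>. f \<xi> * indicator {\<xi>. length \<xi> = Suc k} \<xi> \<partial>count_space {\<xi>. \<xi> \<noteq> []}) =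
        (\<Sum>\<xi> | length \<xi> = Suc k. f \<xi> * indicator {\<xi>. length \<xi> = Suc k} \<xi>)"
      by (intro nn_integral_count_space') auto
    then show "(\<integral>\<^sup>+\<xi>. f \<xi> * indicator {\<xi>. length \<xi> = Suc k} \<xi> \<partial>count_space {\<xi>. \<xi> \<noteq> []}) =
        (\<Sum>\<xi> | length \<xi> = Suc k. f \<xi>)" by simp
  qed
  finally show ?thesis .
qed

section \<open>Integration over the space of loops\<close>

lemma loop_section_eq:
  "loop_section \<xi> A = mk_based_loop \<xi> -` A \<inter> space (path_measure C \<kappa> \<xi>)"
  by (simp add: loop_section_def path_measure_def)

lemma mk_based_loop_measurable:
  assumes "\<xi> \<noteq> []"
  shows "mk_based_loop \<xi> \<in> measurable (path_measure C \<kappa> \<xi>) (based_loop_measure C' \<kappa>')"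
  using mk_based_loop_in_based_loops[OF assms] assms
  by (auto simp: measurable_def path_measure_def based_loop_sets_def loop_section_def)

text \<open>
  The space of based loops is a disjoint union indexed by the discrete paths, so measurability
  and integration reduce to each piece separately.
\<close>

lemma measurable_based_loopI:
  assumes f: "\<And>\<xi>. \<xi> \<noteq> [] \<Longrightarrow> (\<lambda>\<tau>. f (mk_based_loop \<xi> \<tau>)) \<in> measurable (holding_times (length \<xi>)) N"
    and space: "f \<in> based_loops \<rightarrow> space N"
  shows "f \<in> measurable (based_loop_measure C \<kappa>) N"
proof (rule measurableI)
  show "f b \<in> space N" if "b \<in> space (based_loop_measure C \<kappa>)" for b
    using that space by auto
next
  fix B assume B: "B \<in> sets N"
  have "loop_section \<xi> (f -` B \<inter> based_loops) =
      (\<lambda>\<tau>. f (mk_based_loop \<xi> \<tau>)) -` B \<inter> space (holding_times (length \<xi>))" if "\<xi> \<noteq> []" for \<xi>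
    using mk_based_loop_in_based_loops[OF that] by (auto simp: loop_section_def)
  then show "f -` B \<inter> space (based_loop_measure C \<kappa>) \<in> sets (based_loop_measure C \<kappa>)"
    using measurable_sets[OF f B] by (auto simp: based_loop_sets_def)
qed

lemma nn_integral_based_loop_measure:
  fixes C :: "real ^ 'n::finite ^ 'n"
  assumes "f \<in> borel_measurable (based_loop_measure C \<kappa>)"
  shows "(\<integral>\<^sup>+b. f b \<partial>based_loop_measure C \<kappa>) =
    (\<integral>\<^sup>+\<xi>. (\<integral>\<^sup>+\<tau>. f (mk_based_loop \<xi> \<tau>) \<partial>path_measure C \<kappa> \<xi>) \<partial>count_space {\<xi>. \<xi> \<noteq> []})"
  using assms
proof (induction f rule: borel_measurable_induct)
  case (cong f g)
  have "f (mk_based_loop \<xi> \<tau>) = g (mk_based_loop \<xi> \<tau>)"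
    if "\<xi> \<noteq> []" "\<tau> \<in> space (path_measure C \<kappa> \<xi>)" for \<xi> \<tau>
    using cong(3) measurable_space[OF mk_based_loop_measurable[OF that(1)] that(2)] by blast
  then have "(\<integral>\<^sup>+\<xi>. (\<integral>\<^sup>+\<tau>. f (mk_based_loop \<xi> \<tau>) \<partial>path_measure C \<kappa> \<xi>) \<partial>count_space {\<xi>. \<xi> \<noteq> []}) =
      (\<integral>\<^sup>+\<xi>. (\<integral>\<^sup>+\<tau>. g (mk_based_loop \<xi> \<tau>) \<partial>path_measure C \<kappa> \<xi>) \<partial>count_space {\<xi>. \<xi> \<noteq> []})"
    by (intro nn_integral_cong) auto
  moreover have "(\<integral>\<^sup>+b. f b \<partial>based_loop_measure C \<kappa>) = (\<integral>\<^sup>+b. g b \<partial>based_loop_measure C \<kappa>)"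
    by (rule nn_integral_cong) (rule cong(3))
  ultimately show ?case using cong(4) by simp
next
  case (set A)
  have "(\<integral>\<^sup>+\<tau>. indicator A (mk_based_loop \<xi> \<tau>) \<partial>path_measure C \<kappa> \<xi>) =
      emeasure (path_measure C \<kappa> \<xi>) (loop_section \<xi> A)" if "\<xi> \<noteq> []" for \<xi>
    using that set measurable_sets[OF mk_based_loop_measurable[OF that] set]
    by (simp add: loop_section_eq[of \<xi> A C \<kappa>] indicator_vimage[symmetric, unfolded comp_def] nn_integral_indicator')
  with set show ?case by (simp add: emeasure_based_loop_measure cong: nn_integral_cong_simp)
next
  case (mult u c)
  then show ?case
    by (simp add: nn_integral_cmult measurable_compose[OF mk_based_loop_measurable] cong: nn_integral_cong_simp)
next
  case (add u v)
  then show ?case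
    by (simp add: nn_integral_add measurable_compose[OF mk_based_loop_measurable] cong: nn_integral_cong_simp)
next
  case (seq U)
  have sup: "(SUP i. U i) = (\<lambda>b. SUP i. U i b)"
    by (auto simp: fun_eq_iff image_comp)
  have inc: "incseq (\<lambda>i \<tau>. U i (mk_based_loop \<xi> \<tau>))" for \<xi>
    using \<open>incseq U\<close> by (auto simp: incseq_def le_fun_def)
  have "(\<integral>\<^sup>+b. (SUP i. U i) b \<partial>based_loop_measure C \<kappa>) =
      (SUP i. \<integral>\<^sup>+\<xi>. (\<integral>\<^sup>+\<tau>. U i (mk_based_loop \<xi> \<tau>) \<partial>path_measure C \<kappa> \<xi>) \<partial>count_space {\<xi>. \<xi> \<noteq> []})"
    using seq unfolding sup by (simp add: nn_integral_monotone_convergence_SUP)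
  also have "\<dots> = (\<integral>\<^sup>+\<xi>. (SUP i. \<integral>\<^sup>+\<tau>. U i (mk_based_loop \<xi> \<tau>) \<partial>path_measure C \<kappa> \<xi>) \<partial>count_space {\<xi>. \<xi> \<noteq> []})"
    using inc by (intro nn_integral_monotone_convergence_SUP[symmetric])
      (auto simp: incseq_def le_fun_def intro!: nn_integral_mono)
  also have "\<dots> = (\<integral>\<^sup>+\<xi>. (\<integral>\<^sup>+\<tau>. (SUP i. U i) (mk_based_loop \<xi> \<tau>) \<partial>path_measure C \<kappa> \<xi>) \<partial>count_space {\<xi>. \<xi> \<noteq> []})"
    unfolding sup
    by (intro nn_integral_cong nn_integral_monotone_convergence_SUP[symmetric] inc
        measurable_compose[OF mk_based_loop_measurable seq(1)]) simp
  finally show ?case .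
qed

text \<open>
  The loop space carries the quotient \<open>\<sigma>\<close>-algebra, so functions on it are tested on based loops.
\<close>

lemma measurable_loop_spaceI:
  assumes f: "(\<lambda>b. f (loop_of b)) \<in> measurable (based_loop_measure C \<kappa>) N"
  shows "f \<in> measurable loop_space N"
proof (rule measurableI)
  have space: "space loop_space = based_loops // (rotation_rel :: (('a \<times> real) list \<times> _) set)"
    unfolding loop_space_def by (rule space_measure_of) auto
  show "f l \<in> space N" if "l \<in> space loop_space" for l
  proof -
    from that obtain b where "b \<in> based_loops" "l = loop_of b"
      unfolding space loop_of_def by (rule quotientE)
    then show ?thesis using measurable_space[OF f] by auto
  qed
  fix B assume "B \<in> sets N"
  from measurable_sets[OF f this]
  have "(\<lambda>b. f (loop_of b)) -` B \<inter> based_loops \<in> based_loop_sets" by simp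
  moreover have "loop_of -` (f -` B \<inter> space loop_space) \<inter> based_loops =
      (\<lambda>b. f (loop_of b)) -` B \<inter> based_loops"
    by (auto simp: space loop_of_def quotientI)
  ultimately show "f -` B \<inter> space loop_space \<in> sets loop_space"
    unfolding loop_space_def by (auto simp: sets_measure_of space[unfolded loop_space_def] intro!: sigma_sets.Basic)
qed

section \<open>Exponential holding times\<close>

lemma product_sigma_finite_holding_times:
  "product_sigma_finite (\<lambda>i::nat. restrict_space lborel {0<..} :: real measure)"
  unfolding product_sigma_finite_def
  by (auto intro: sigma_finite_measure_restrict_space sigma_finite_lborel)

lemma holding_times_component_measurable [measurable]:
  "i < p \<Longrightarrow> (\<lambda>\<tau>. \<tau> i) \<in> borel_measurable (holding_times p)"
  unfolding holding_times_def
  by (rule measurable_compose[where N = "restrict_space lborel {0<..}"])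
    (auto intro: measurable_component_singleton measurable_restrict_space1)

lemma nn_integral_half_line:
  "(\<integral>\<^sup>+t. f t \<partial>restrict_space lborel {0<..}) = (\<integral>\<^sup>+t. f t * indicator {0<..} t \<partial>(lborel :: real measure))"
  by (rule nn_integral_restrict_space) simp

lemma nn_integral_exp_half_line:
  assumes "0 < a"
  shows "(\<integral>\<^sup>+t. ennreal (exp (- (a * t))) \<partial>restrict_space lborel {0<..}) = ennreal (1 / a)"
proof -
  have "(\<integral>\<^sup>+t. ennreal (exp (- (a * t))) \<partial>restrict_space lborel {0<..}) =
      (\<integral>\<^sup>+t. ennreal (exp (- (a * t))) * indicator {0..} t \<partial>lborel)"
    unfolding nn_integral_half_line
    by (rule nn_integral_cong_AE, rule AE_mp[OF AE_lborel_singleton[of 0]]) (auto simp: indicator_def)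
  also have "\<dots> = ennreal (0 - (- exp (- (a * 0)) / a))"
  proof (rule nn_integral_FTC_atLeast)
    show "((\<lambda>t. - exp (- (a * t)) / a) \<longlongrightarrow> 0) at_top"
    proof -
      have "filterlim (\<lambda>t. - (a * t)) at_bot at_top"
        using assms by (simp add: filterlim_uminus_at_bot filterlim_tendsto_pos_mult_at_top[OF tendsto_const _ filterlim_ident])
      then have "((\<lambda>t. exp (- (a * t))) \<longlongrightarrow> 0) at_top"
        by (rule filterlim_compose[OF exp_at_bot])
      from tendsto_divide[OF tendsto_minus[OF this] tendsto_const, of a] assms show ?thesis by simp
    qed
    show "DERIV (\<lambda>t. - exp (- (a * t)) / a) t :> exp (- (a * t))" for t
      using assms by (auto intro!: derivative_eq_intros)
  qed auto
  finally show ?thesis by simp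
qed

lemma nn_integral_prod_exp:
  assumes a: "\<And>i. i < p \<Longrightarrow> 0 < a i" and c: "\<And>i. i < p \<Longrightarrow> 0 \<le> c i"
  shows "(\<integral>\<^sup>+\<tau>. ennreal (\<Prod>i<p. c i * exp (- (a i * \<tau> i))) \<partial>holding_times p) = ennreal (\<Prod>i<p. c i / a i)"
proof -
  interpret product_sigma_finite "\<lambda>i::nat. restrict_space lborel {0<..} :: real measure"
    by (rule product_sigma_finite_holding_times)
  have meas: "(\<lambda>t. ennreal (c i * exp (- (a i * t)))) \<in> borel_measurable (restrict_space lborel {0<..})" for i
    by (rule measurable_restrict_space1) simp
  have "(\<integral>\<^sup>+\<tau>. ennreal (\<Prod>i<p. c i * exp (- (a i * \<tau> i))) \<partial>holding_times p) =
      (\<integral>\<^sup>+\<tau>. (\<Prod>i<p. ennreal (c i * exp (- (a i * \<tau> i)))) \<partial>holding_times p)"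
    by (intro nn_integral_cong prod_ennreal[symmetric]) (simp add: c)
  also have "\<dots> = (\<Prod>i<p. \<integral>\<^sup>+t. ennreal (c i * exp (- (a i * t))) \<partial>restrict_space lborel {0<..})"
    unfolding holding_times_def by (rule product_nn_integral_prod) (auto intro: meas)
  also have "\<dots> = (\<Prod>i<p. ennreal (c i / a i))"
  proof (rule prod.cong)
    fix i assume "i \<in> {..<p}"
    then have "0 < a i" "0 \<le> c i" using a c by auto
    have "(\<integral>\<^sup>+t. ennreal (c i * exp (- (a i * t))) \<partial>restrict_space lborel {0<..}) =
        ennreal (c i) * (\<integral>\<^sup>+t. ennreal (exp (- (a i * t))) \<partial>restrict_space lborel {0<..})"
      using \<open>0 \<le> c i\<close> by (simp add: ennreal_mult nn_integral_cmult measurable_restrict_space1)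
    then show "(\<integral>\<^sup>+t. ennreal (c i * exp (- (a i * t))) \<partial>restrict_space lborel {0<..}) = ennreal (c i / a i)"
      using \<open>0 < a i\<close> \<open>0 \<le> c i\<close> by (simp add: nn_integral_exp_half_line ennreal_mult[symmetric])
  qed simp
  also have "\<dots> = ennreal (\<Prod>i<p. c i / a i)"
    using a c by (intro prod_ennreal) (auto intro: divide_nonneg_pos)
  finally show ?thesis .
qed

text \<open>
  The quotient is itself an integral, \<open>(1 - exp (- w t)) exp (- a t) / t = \<integral> exp (- u t) du\<close> over
  \<open>a \<le> u \<le> a + w\<close>. Exchanging the two integrals leaves \<open>\<integral> 1 / u du\<close>.
\<close>

lemma nn_integral_frullani:
  assumes "0 < a" "0 \<le> w"
  shows "(\<integral>\<^sup>+t. ennreal ((1 - exp (- (w * t))) * exp (- (a * t)) / t) \<partial>restrict_space lborel {0<..}) =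
    ennreal (ln ((a + w) / a))"
proof -
  have inner: "(\<integral>\<^sup>+u. ennreal (exp (- (u * t))) * indicator {a..a + w} u \<partial>lborel) =
      ennreal ((1 - exp (- (w * t))) * exp (- (a * t)) / t)" if "0 < t" for t
  proof -
    have "(\<integral>\<^sup>+u. ennreal (exp (- (u * t))) * indicator {a..a + w} u \<partial>lborel) =
        ennreal (- exp (- ((a + w) * t)) / t - (- exp (- (a * t)) / t))"
    proof (rule nn_integral_FTC_Icc[where F = "\<lambda>u. - exp (- (u * t)) / t"])
      show "DERIV (\<lambda>u. - exp (- (u * t)) / t) u :> exp (- (u * t))" for u
        using that by (auto intro!: derivative_eq_intros)
    qed (use assms in auto)
    also have "- exp (- ((a + w) * t)) / t - (- exp (- (a * t)) / t) =
        (1 - exp (- (w * t))) * exp (- (a * t)) / t"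
      using that by (simp add: field_simps flip: exp_add)
    finally show ?thesis .
  qed
  have "(\<integral>\<^sup>+t. ennreal ((1 - exp (- (w * t))) * exp (- (a * t)) / t) \<partial>restrict_space lborel {0<..}) =
      (\<integral>\<^sup>+t. (\<integral>\<^sup>+u. ennreal (exp (- (u * t))) * indicator {a..a + w} u * indicator {0<..} t \<partial>lborel) \<partial>lborel)"
    unfolding nn_integral_half_line
  proof (rule nn_integral_cong)
    fix t :: real
    show "ennreal ((1 - exp (- (w * t))) * exp (- (a * t)) / t) * indicator {0<..} t =
        (\<integral>\<^sup>+u. ennreal (exp (- (u * t))) * indicator {a..a + w} u * indicator {0<..} t \<partial>lborel)"
      by (cases "0 < t") (simp_all add: inner)
  qed
  also have "\<dots> = (\<integral>\<^sup>+u. (\<integral>\<^sup>+t. ennreal (exp (- (u * t))) * indicator {a..a + w} u * indicator {0<..} t \<partial>lborel) \<partial>lborel)"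
    by (rule lborel_pair.Fubini') measurable
  also have "\<dots> = (\<integral>\<^sup>+u. ennreal (1 / u) * indicator {a..a + w} u \<partial>lborel)"
  proof (rule nn_integral_cong)
    fix u :: real
    show "(\<integral>\<^sup>+t. ennreal (exp (- (u * t))) * indicator {a..a + w} u * indicator {0<..} t \<partial>lborel) =
        ennreal (1 / u) * indicator {a..a + w} u"
      using nn_integral_exp_half_line[of u] assms
      unfolding nn_integral_half_line
      by (auto simp: indicator_def)
  qed
  also have "\<dots> = ennreal (ln (a + w) - ln a)"
  proof (rule nn_integral_FTC_Icc[where F = ln])
    show "DERIV ln u :> 1 / u" if "u \<in> {a..a + w}" for u
      using assms that by (auto intro!: derivative_eq_intros)
  qed (use assms in auto)
  also have "ln (a + w) - ln a = ln ((a + w) / a)"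
    using assms by (simp add: ln_div)
  finally show ?thesis .
qed

section \<open>The weight of a discrete loop\<close>

lemma based_occupation_mk_based_loop:
  "based_occupation (mk_based_loop \<xi> \<tau>) x = (\<Sum>i<length \<xi>. if \<xi> ! i = x then \<tau> i else 0)"
  by (auto simp: based_occupation_def mk_based_loop_def intro!: sum.cong)

lemma occupation_pairing_mk_based_loop:
  fixes \<xi> :: "'n::finite list"
  shows "(\<Sum>x\<in>UNIV. based_occupation (mk_based_loop \<xi> \<tau>) x * chi $ x) = (\<Sum>i<length \<xi>. chi $ (\<xi> ! i) * \<tau> i)"
proof -
  have "(\<Sum>x\<in>UNIV. based_occupation (mk_based_loop \<xi> \<tau>) x * chi $ x) =
      (\<Sum>i<length \<xi>. \<Sum>x\<in>UNIV. if \<xi> ! i = x then chi $ x * \<tau> i else 0)"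
    by (subst sum.swap) (auto simp: based_occupation_mk_based_loop sum_distrib_right intro!: sum.cong)
  then show ?thesis by simp
qed

text \<open>
  For at least two points, the factor \<open>exp (- \<langle>l, \<chi>\<rangle>)\<close> is absorbed into the exponential weights by
  raising the rates from \<open>\<lambda>\<close> to \<open>\<lambda> + \<chi>\<close>, and both resulting integrals are finite products. A single
  point carries the singular weight \<open>d\<tau> / \<tau>\<close> instead; only the difference of the two terms is
  integrable there. Since \<open>C\<close> vanishes on the diagonal, the cyclic products vanish for one-point
  loops, so one formula covers both cases.
\<close>

lemma nn_integral_loops_through:
  fixes C :: "real ^ 'n::finite ^ 'n"
  assumes C: "\<And>x y. 0 \<le> C $ x $ y" "\<And>x. C $ x $ x = 0"
    and rate: "\<And>x. 0 < total_rate C \<kappa> $ x" and chi: "\<And>x. 0 \<le> chi $ x"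
    and "\<xi> \<noteq> []"
  defines "lam \<equiv> total_rate C \<kappa>"
  defines "cyc \<equiv> \<lambda>r. \<Prod>i<length \<xi>. jump_matrix C r $ (\<xi> ! i) $ (\<xi> ! ((i + 1) mod length \<xi>))"
  shows "(\<integral>\<^sup>+\<tau>. ennreal (1 - exp (- (\<Sum>x\<in>UNIV. based_occupation (mk_based_loop \<xi> \<tau>) x * chi $ x)))
      \<partial>path_measure C \<kappa> \<xi>) =
    ennreal ((if length \<xi> = 1 then ln ((lam + chi) $ (\<xi> ! 0) / lam $ (\<xi> ! 0)) else 0)
      + (cyc lam - cyc (lam + chi)) / real (length \<xi>))" (is "?I = _")
    and "0 \<le> (if length \<xi> = 1 then ln ((lam + chi) $ (\<xi> ! 0) / lam $ (\<xi> ! 0)) else 0)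
      + (cyc lam - cyc (lam + chi)) / real (length \<xi>)"
proof -
  define p where "p = length \<xi>"
  have p: "0 < p" using \<open>\<xi> \<noteq> []\<close> by (simp add: p_def)
  define D where "D r \<tau> = (\<Prod>i<p. C $ (\<xi> ! i) $ (\<xi> ! ((i + 1) mod p)) * exp (- (r $ (\<xi> ! i) * \<tau> i)))"
    for r :: "real ^ 'n" and \<tau> :: "nat \<Rightarrow> real"
  have lam: "0 < lam $ x" for x using rate by (simp add: lam_def)
  have D_meas [measurable]: "D r \<in> borel_measurable (holding_times p)" for r
    unfolding D_def by measurable
  have D_nonneg: "0 \<le> D r \<tau>" for r \<tau>
    unfolding D_def by (intro prod_nonneg) (auto simp: C)
  have pos: "0 < \<tau> i" if "\<tau> \<in> space (holding_times p)" "i < p" for \<tau> i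
    using that by (auto simp: holding_times_def space_PiM PiE_def Pi_def space_restrict_space)
  have exp_split: "exp (- (w * t)) * (c * exp (- (l * t))) = c * exp (- ((l + w) * t))" for w t c l :: real
  proof -
    have "exp (- ((l + w) * t)) = exp (- (w * t)) * exp (- (l * t))"
      by (simp add: algebra_simps flip: exp_add)
    then show ?thesis by simp
  qed
  have D_split: "exp (- (\<Sum>i<p. chi $ (\<xi> ! i) * \<tau> i)) * D lam \<tau> = D (lam + chi) \<tau>" for \<tau>
    unfolding D_def sum_negf[symmetric] exp_sum[OF finite_lessThan] prod.distrib[symmetric]
    by (intro prod.cong) (simp_all add: exp_split)
  have D_mono: "D (lam + chi) \<tau> \<le> D lam \<tau>" if "\<tau> \<in> space (holding_times p)" for \<tau>
  proof -
    have "0 \<le> (\<Sum>i<p. chi $ (\<xi> ! i) * \<tau> i)"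
      using pos[OF that] by (intro sum_nonneg mult_nonneg_nonneg chi) (simp add: less_imp_le)
    then show ?thesis
      unfolding D_split[symmetric] by (intro mult_left_le_one_le D_nonneg) auto
  qed
  have D_int: "(\<integral>\<^sup>+\<tau>. ennreal (D r \<tau>) \<partial>holding_times p) = ennreal (cyc r)" if "\<And>x. 0 < r $ x" for r
    unfolding D_def cyc_def
    by (subst nn_integral_prod_exp) (auto simp: that C jump_matrix_def p_def)
  have lam': "0 < (lam + chi) $ x" for x using lam[of x] chi[of x] by simp
  have cyc_nonneg: "0 \<le> cyc (lam + chi)"
    using lam' unfolding cyc_def by (intro prod_nonneg) (auto simp: jump_matrix_def C less_imp_le)
  have cyc_mono: "cyc (lam + chi) \<le> cyc lam"
    using lam chi unfolding cyc_def
    by (intro prod_mono) (auto simp: jump_matrix_def C intro!: divide_left_mono divide_nonneg_pos mult_pos_pos add_pos_nonneg)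
  have pairing_meas: "(\<lambda>\<tau>. \<Sum>i<p. chi $ (\<xi> ! i) * \<tau> i) \<in> borel_measurable (holding_times p)"
    by measurable
  have density_meas: "loop_density C \<kappa> \<xi> \<in> borel_measurable (holding_times p)"
    unfolding loop_density_def Let_def using p
    by (cases "p = 1") (auto simp: p_def[symmetric] intro!: borel_measurable_times borel_measurable_prod)
  have density_nonneg: "0 \<le> loop_density C \<kappa> \<xi> \<tau>" if "\<tau> \<in> space (holding_times p)" for \<tau>
    using pos[OF that, of 0, THEN less_imp_le] p
    by (auto simp: loop_density_def Let_def C p_def intro!: prod_nonneg divide_nonneg_nonneg mult_nonneg_nonneg)
  have "?I = (\<integral>\<^sup>+\<tau>. ennreal (loop_density C \<kappa> \<xi> \<tau>) * ennreal (1 - exp (- (\<Sum>i<p. chi $ (\<xi> ! i) * \<tau> i)))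
      \<partial>holding_times p)"
    unfolding path_measure_def occupation_pairing_mk_based_loop p_def[symmetric]
    using density_meas pairing_meas by (subst nn_integral_density) auto
  also have "\<dots> = (\<integral>\<^sup>+\<tau>. ennreal ((1 - exp (- (\<Sum>i<p. chi $ (\<xi> ! i) * \<tau> i))) * loop_density C \<kappa> \<xi> \<tau>)
      \<partial>holding_times p)"
    by (intro nn_integral_cong) (subst ennreal_mult''[OF density_nonneg], simp_all only: mult.commute)
  finally have I: "?I = \<dots>" .
  show "?I = ennreal ((if length \<xi> = 1 then ln ((lam + chi) $ (\<xi> ! 0) / lam $ (\<xi> ! 0)) else 0)
      + (cyc lam - cyc (lam + chi)) / real (length \<xi>))"
  proof (cases "p = 1")
    case True
    interpret product_sigma_finite "\<lambda>i::nat. restrict_space lborel {0<..} :: real measure"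
      by (rule product_sigma_finite_holding_times)
    have zero: "cyc r = 0" for r
      using True by (simp add: cyc_def p_def jump_matrix_def C)
    let ?f = "\<lambda>t. ennreal ((1 - exp (- (chi $ (\<xi> ! 0) * t))) * exp (- (lam $ (\<xi> ! 0) * t)) / t)"
    have "?I = (\<integral>\<^sup>+\<tau>. ?f (\<tau> 0) \<partial>Pi\<^sub>M {0::nat} (\<lambda>_. restrict_space lborel {0<..}))"
      unfolding I using True
      by (simp add: loop_density_def Let_def p_def holding_times_def lam_def lessThan_Suc)
    also have "\<dots> = (\<integral>\<^sup>+t. ?f t \<partial>restrict_space lborel {0<..})"
      by (rule product_nn_integral_singleton) (simp add: measurable_restrict_space1)
    also have "\<dots> = ennreal (ln ((lam + chi) $ (\<xi> ! 0) / lam $ (\<xi> ! 0)))"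
      using nn_integral_frullani[OF lam chi] by simp
    finally show ?thesis using True by (simp add: p_def zero)
  next
    case False
    have "loop_density C \<kappa> \<xi> \<tau> = 1 / real p * D lam \<tau>" for \<tau>
      using False by (simp add: loop_density_def Let_def D_def p_def lam_def)
    then have "(1 - exp (- (\<Sum>i<p. chi $ (\<xi> ! i) * \<tau> i))) * loop_density C \<kappa> \<xi> \<tau> =
        1 / real p * (D lam \<tau> - D (lam + chi) \<tau>)" for \<tau>
      unfolding D_split[symmetric] by (simp add: left_diff_distrib diff_divide_distrib)
    then have "?I = (\<integral>\<^sup>+\<tau>. ennreal (1 / real p) * (ennreal (D lam \<tau>) - ennreal (D (lam + chi) \<tau>)) \<partial>holding_times p)"
      unfolding I
      by (intro nn_integral_cong)
        (simp only:, subst ennreal_mult', simp, simp only: ennreal_minus D_nonneg)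
    also have "\<dots> = ennreal (1 / real p) * (ennreal (cyc lam) - ennreal (cyc (lam + chi)))"
      using D_int[of lam] D_int[of "lam + chi"] lam lam' D_mono
      by (subst nn_integral_cmult, simp, subst nn_integral_diff) (auto intro!: AE_I2 ennreal_leI)
    also have "\<dots> = ennreal ((cyc lam - cyc (lam + chi)) / real p)"
      using cyc_nonneg cyc_mono by (simp add: ennreal_minus ennreal_mult[symmetric])
    finally show ?thesis using False by (simp add: p_def)
  qed
  show "0 \<le> (if length \<xi> = 1 then ln ((lam + chi) $ (\<xi> ! 0) / lam $ (\<xi> ! 0)) else 0)
      + (cyc lam - cyc (lam + chi)) / real (length \<xi>)"
    using cyc_mono lam chi by (auto intro!: add_nonneg_nonneg ln_ge_zero divide_nonneg_nonneg)
qed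

section \<open>The Laplace functional of the occupation field\<close>

text \<open>
  The sum over all discrete loops. The logarithms from the one-point loops cancel the sums of
  \<open>ln r\<^sub>x\<close> in \<open>jump_matrix_trace_series\<close>, which leaves only the two determinants.
\<close>

lemma nn_integral_loop_measure:
  fixes C :: "real ^ 'n::finite ^ 'n"
  assumes C: "\<And>x y. 0 \<le> C $ x $ y" "\<And>x. C $ x $ x = 0" and \<kappa>: "\<And>x. 0 \<le> \<kappa> $ x"
    and rate: "\<And>x. 0 < total_rate C \<kappa> $ x" and chi: "\<And>x. 0 \<le> chi $ x"
    and pd: "positive_definite (diag_matrix (total_rate C \<kappa>) - C)"
  defines "A \<equiv> diag_matrix (total_rate C \<kappa>) - C"
  defines "f \<equiv> \<lambda>l. 1 - exp (- (\<Sum>x\<in>UNIV. occupation l x * chi $ x))"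
  shows "f \<in> borel_measurable (loop_measure C \<kappa>)"
    and "(\<integral>\<^sup>+l. ennreal (f l) \<partial>loop_measure C \<kappa>) = ennreal (ln (det (A + diag_matrix chi) / det A))"
    and "0 < det A" and "0 < det (A + diag_matrix chi)" and "0 \<le> ln (det (A + diag_matrix chi) / det A)"
proof -
  define lam where "lam = total_rate C \<kappa>"
  have lam: "0 < lam $ x" for x using rate by (simp add: lam_def)
  have lam': "0 < (lam + chi) $ x" for x using lam[of x] chi[of x] by simp
  have rows: "(\<Sum>y\<in>UNIV. C $ x $ y) \<le> lam $ x" for x
    using \<kappa> by (simp add: lam_def total_rate_def)
  have rows': "(\<Sum>y\<in>UNIV. C $ x $ y) \<le> (lam + chi) $ x" for x
    using rows[of x] chi[of x] by simp
  have A: "A = diag_matrix lam - C" by (simp add: A_def lam_def)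
  have A': "A + diag_matrix chi = diag_matrix (lam + chi) - C"
    by (simp add: A diag_matrix_def vec_eq_iff)
  have det_A: "det (diag_matrix lam - C) \<noteq> 0"
    using positive_definite_imp_det_nonzero[OF pd] by (simp add: lam_def)
  have det_A': "det (diag_matrix (lam + chi) - C) \<noteq> 0"
    unfolding A'[symmetric] A_def
    by (intro positive_definite_imp_det_nonzero positive_definite_add_diag_matrix pd chi)
  note series = jump_matrix_trace_series[OF C(1) lam rows det_A]
  note series' = jump_matrix_trace_series[OF C(1) lam' rows' det_A']
  show pos_A: "0 < det A" using series(1) by (simp add: A)
  show pos_A': "0 < det (A + diag_matrix chi)" using series'(1) by (simp add: A')

  define fb where "fb b = 1 - exp (- (\<Sum>x\<in>UNIV. based_occupation b x * chi $ x))" for b :: "('n \<times> real) list"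
  have f_fb: "f (loop_of b) = fb b" if "b \<in> based_loops" for b
    using that by (simp add: f_def fb_def occupation_loop_of)
  have fb_meas: "fb \<in> borel_measurable (based_loop_measure C \<kappa>)"
  proof (rule measurable_based_loopI)
    show "(\<lambda>\<tau>. fb (mk_based_loop \<xi> \<tau>)) \<in> borel_measurable (holding_times (length \<xi>))" for \<xi>
      unfolding fb_def occupation_pairing_mk_based_loop by measurable
  qed simp
  then have "(\<lambda>b. f (loop_of b)) \<in> borel_measurable (based_loop_measure C \<kappa>)"
    by (subst measurable_cong[of _ _ fb]) (auto simp: f_fb)
  then have f_meas: "f \<in> borel_measurable loop_space" by (rule measurable_loop_spaceI)
  then show "f \<in> borel_measurable (loop_measure C \<kappa>)"
    by (simp add: loop_measure_def)

  define cyc where "cyc r \<xi> = (\<Prod>i<length \<xi>. jump_matrix C r $ (\<xi> ! i) $ (\<xi> ! ((i + 1) mod length \<xi>)))"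
    for r and \<xi> :: "'n list"
  define g where "g \<xi> = (if length \<xi> = 1 then ln ((lam + chi) $ (\<xi> ! 0) / lam $ (\<xi> ! 0)) else 0)
      + (cyc lam \<xi> - cyc (lam + chi) \<xi>) / real (length \<xi>)" for \<xi> :: "'n list"
  have path: "(\<integral>\<^sup>+\<tau>. ennreal (fb (mk_based_loop \<xi> \<tau>)) \<partial>path_measure C \<kappa> \<xi>) = ennreal (g \<xi>)"
    and g_nonneg: "0 \<le> g \<xi>" if "\<xi> \<noteq> []" for \<xi>
    using nn_integral_loops_through[OF C rate chi that] by (simp_all only: fb_def g_def cyc_def lam_def)

  define L where "L = (\<Sum>x\<in>UNIV. ln ((lam + chi) $ x / lam $ x))"
  \<comment> \<open>The total contribution of the loops with k points.\<close>
  define a where "a k = (if k = 1 then L else 0)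
      + (trace (matrix_pow (jump_matrix C lam) k) / real k
        - trace (matrix_pow (jump_matrix C (lam + chi)) k) / real k)" for k
  have sum_g: "(\<Sum>\<xi> | length \<xi> = Suc k. g \<xi>) = a (Suc k)" for k
  proof -
    have cyc_sum: "(\<Sum>\<xi> | length \<xi> = Suc k. cyc r \<xi>) = trace (matrix_pow (jump_matrix C r) (Suc k))" for r
      using sum_cyclic_prod_eq_trace[of "Suc k" "jump_matrix C r"] by (simp add: cyc_def del: matrix_pow.simps prod.lessThan_Suc)
    have one: "(\<Sum>\<xi> | length \<xi> = Suc k. if length \<xi> = 1 then ln ((lam + chi) $ (\<xi> ! 0) / lam $ (\<xi> ! 0)) else 0)
        = (if Suc k = 1 then L else 0)"
      unfolding sum_lists_length_Suc by (cases k) (simp_all add: L_def)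
    have "(\<Sum>\<xi> | length \<xi> = Suc k. g \<xi>) =
        (\<Sum>\<xi> | length \<xi> = Suc k. if length \<xi> = 1 then ln ((lam + chi) $ (\<xi> ! 0) / lam $ (\<xi> ! 0)) else 0)
        + (\<Sum>\<xi> | length \<xi> = Suc k. (cyc lam \<xi> - cyc (lam + chi) \<xi>) / real (Suc k))"
      unfolding g_def sum.distrib by simp
    also have "\<dots> = a (Suc k)"
      unfolding one sum_divide_distrib[symmetric] sum_subtractf cyc_sum
      by (simp only: a_def diff_divide_distrib)
    finally show ?thesis .
  qed
  \<comment> \<open>The empty path is not a loop, and the series has no term of order zero either.\<close>
  have a_0: "a 0 = 0"
    by (simp add: a_def)
  have "a sums (L + (((\<Sum>x\<in>UNIV. ln (lam $ x)) - ln (det A))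
      - ((\<Sum>x\<in>UNIV. ln ((lam + chi) $ x)) - ln (det (A + diag_matrix chi)))))"
    unfolding a_def A' unfolding A using sums_single[of 1 "\<lambda>_. L"]
    by (intro sums_add sums_diff series(2) series'(2)) simp
  also have "L + (((\<Sum>x\<in>UNIV. ln (lam $ x)) - ln (det A))
      - ((\<Sum>x\<in>UNIV. ln ((lam + chi) $ x)) - ln (det (A + diag_matrix chi)))) =
      ln (det (A + diag_matrix chi) / det A)"
  proof -
    have "L = (\<Sum>x\<in>UNIV. ln ((lam + chi) $ x)) - (\<Sum>x\<in>UNIV. ln (lam $ x))"
      using lam lam' by (simp add: L_def ln_div sum_subtractf less_imp_neq[symmetric] del: vector_add_component)
    then show ?thesis using pos_A pos_A' by (simp add: ln_div)
  qed
  finally have a_sums: "(\<lambda>k. a (Suc k)) sums ln (det (A + diag_matrix chi) / det A)"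
    by (subst sums_Suc_iff) (simp add: a_0)
  have a_nonneg: "0 \<le> a (Suc k)" for k
    unfolding sum_g[symmetric] by (intro sum_nonneg g_nonneg) auto
  have a_suminf: "(\<Sum>k. ennreal (a (Suc k))) = ennreal (ln (det (A + diag_matrix chi) / det A))"
    by (intro suminf_ennreal_eq a_nonneg a_sums)
  show "0 \<le> ln (det (A + diag_matrix chi) / det A)"
    by (rule sums_le[OF a_nonneg sums_zero a_sums])

  have "(\<integral>\<^sup>+l. ennreal (f l) \<partial>loop_measure C \<kappa>) = (\<integral>\<^sup>+b. ennreal (f (loop_of b)) \<partial>based_loop_measure C \<kappa>)"
    unfolding loop_measure_def using f_meas by (intro nn_integral_distr loop_of_measurable) auto
  also have "\<dots> = (\<integral>\<^sup>+b. ennreal (fb b) \<partial>based_loop_measure C \<kappa>)"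
    by (intro nn_integral_cong) (simp add: f_fb)
  also have "\<dots> = (\<integral>\<^sup>+\<xi>. ennreal (g \<xi>) \<partial>count_space {\<xi>. \<xi> \<noteq> []})"
    using fb_meas by (subst nn_integral_based_loop_measure) (auto simp: path intro!: nn_integral_cong)
  also have "\<dots> = (\<Sum>k. ennreal (a (Suc k)))"
    unfolding nn_integral_nonempty_lists_by_length sum_g[symmetric]
    by (intro suminf_cong sum_ennreal g_nonneg) auto
  also note a_suminf
  finally show "(\<integral>\<^sup>+l. ennreal (f l) \<partial>loop_measure C \<kappa>) = ennreal (ln (det (A + diag_matrix chi) / det A))" .
qed

theorem proposition1:
  fixes C :: "real ^ 'n ^ 'n::finite" and \<kappa> chi :: "real ^ 'n"
  assumes "transpose C = C"
    and "\<And>x y. 0 \<le> C $ x $ y"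
    and "\<And>x. C $ x $ x = 0"
    and "irreducible_conductances C"
    and "\<And>x. 0 \<le> \<kappa> $ x"
    and "\<And>x. 0 < total_rate C \<kappa> $ x"
    and "positive_definite (diag_matrix (total_rate C \<kappa>) - C)"
    and "\<And>x. 0 \<le> chi $ x"
  shows "integrable (loop_measure C \<kappa>)
        (\<lambda>l. exp (- (\<Sum>x\<in>UNIV. occupation l x * chi $ x)) - 1)
    \<and> 0 < det (mat 1 + green C \<kappa> ** diag_matrix chi)
    \<and> 0 < det (mat 1 - green_killed C \<kappa> chi ** diag_matrix chi)
    \<and> 0 < det (green_killed C \<kappa> chi ** matrix_inv (green C \<kappa>))
    \<and> (\<integral>l. (exp (- (\<Sum>x\<in>UNIV. occupation l x * chi $ x)) - 1) \<partial>loop_measure C \<kappa>)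
        = - ln (det (mat 1 + green C \<kappa> ** diag_matrix chi))
    \<and> - ln (det (mat 1 + green C \<kappa> ** diag_matrix chi))
        = ln (det (mat 1 - green_killed C \<kappa> chi ** diag_matrix chi))
    \<and> ln (det (mat 1 - green_killed C \<kappa> chi ** diag_matrix chi))
        = ln (det (green_killed C \<kappa> chi ** matrix_inv (green C \<kappa>)))"
proof -
  let ?A = "diag_matrix (total_rate C \<kappa>) - C"
  let ?A' = "?A + diag_matrix chi"
  let ?G = "green C \<kappa>" and ?G' = "green_killed C \<kappa> chi"
  let ?f = "\<lambda>l. 1 - exp (- (\<Sum>x\<in>UNIV. occupation l x * chi $ x))"
  note loops = nn_integral_loop_measure[of C \<kappa> chi, OF assms(2,3,5,6,8,7)]
  have G: "?G ** ?A = mat 1" "?A ** ?G = mat 1"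
    using matrix_inv_mult[of ?A] loops(3) by (simp_all add: green_def)
  have G': "?G' ** ?A' = mat 1"
    using matrix_inv_mult[of ?A'] loops(4) by (simp add: green_killed_def algebra_simps)
  have det_G: "det ?G * det ?A = 1" and det_G': "det ?G' * det ?A' = 1"
    using G(1) G' by (metis det_mul det_I)+
  have "det ?G \<noteq> 0" using det_G by auto
  then have "matrix_inv ?G = ?A ** (?G ** matrix_inv ?G)"
    by (simp add: matrix_mul_assoc G)
  then have inv_G: "matrix_inv ?G = ?A"
    using \<open>det ?G \<noteq> 0\<close> by (simp add: matrix_inv_mult)
  have "mat 1 + ?G ** diag_matrix chi = ?G ** ?A'"
    by (simp add: matrix_add_ldistrib G)
  then have det1: "det (mat 1 + ?G ** diag_matrix chi) = det ?A' / det ?A"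
    using det_G loops(3) by (simp add: det_mul field_simps)
  have "?G' ** ?A' = ?G' ** ?A + ?G' ** diag_matrix chi"
    by (rule matrix_add_ldistrib)
  then have "mat 1 - ?G' ** diag_matrix chi = ?G' ** ?A"
    by (simp add: G')
  then have det2: "det (mat 1 - ?G' ** diag_matrix chi) = det ?A / det ?A'"
    using det_G' loops(4) by (simp add: det_mul field_simps)
  have det3: "det (?G' ** matrix_inv ?G) = det ?A / det ?A'"
    using det_G' loops(4) by (simp add: inv_G det_mul field_simps)
  have "has_bochner_integral (loop_measure C \<kappa>) ?f (ln (det ?A' / det ?A))"
  proof (rule has_bochner_integral_nn_integral[OF loops(1) _ loops(5) loops(2)])
    have "0 \<le> occupation l x" if "l \<in> space (loop_measure C \<kappa>)" for l x
    proof -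
      from that have "l \<in> based_loops // rotation_rel"
        by (simp add: loop_measure_def loop_space_def space_measure_of_conv)
      then obtain b where b: "b \<in> based_loops" "l = loop_of b"
        unfolding loop_of_def by (rule quotientE)
      then have "0 \<le> snd (b ! i)" if "i < length b" for i
        using nth_mem[OF that] by (fastforce simp: based_loops_def)
      then show ?thesis
        using b by (auto simp: occupation_loop_of based_occupation_def intro!: sum_nonneg)
    qed
    then show "AE l in loop_measure C \<kappa>. 0 \<le> ?f l"
      using assms(8) by (auto intro!: AE_I2 sum_nonneg mult_nonneg_nonneg)
  qed
  from has_bochner_integral_minus[OF this]
  have "has_bochner_integral (loop_measure C \<kappa>)
      (\<lambda>l. exp (- (\<Sum>x\<in>UNIV. occupation l x * chi $ x)) - 1) (- ln (det ?A' / det ?A))"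
    by simp
  then show ?thesis
    using loops(3,4) by (auto simp: det1 det2 det3 has_bochner_integral_iff ln_div)
qed

end
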